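(* Let $A$ be an arbitrary, possibly infinite, nonempty set. For any set $\mathcal{W} \subseteq \mathcal{W}_A$ of systems of pointed multisets on $A$, the following two conditions are equivalent: (i) $\mathcal{W}$ is locally closed and contains the binary equality system, the unary empty system, and all unary trivial systems of breadth $p$ for $p \ge 0$, and it is closed under formation of conjunctive minors, unions, quotients, and dividends. (ii) $\mathcal{W}$ is characterized by some set $\mathcal{F} \subseteq \mathcal{O}_A$ of operations, i.e., there is $\mathcal{F} \subseteq \mathcal{O}_A$ such that $\mathcal{W} = \{(\Phi,\Phi') \in \mathcal{W}_A \mid f \text{ preserves } (\Phi,\Phi') \text{ for all } f \in \mathcal{F}\}$.
   Context: Operations, systems, preservation. An operation on $A$ is a map $f\colon A^n \to A$ for some integer $n \ge 1$; $\mathcal{O}_A$ is the set of all operations on $A$. $\mathcal{M}(B)$ is the set of finite multisets on a set $B$ (multiplicity functions $\nu_S\colon B\to\{0,1,2,\dots\}$ with finite support); $|S|$ is the sum of multiplicities, $S'\subseteq S$ means $\nu_{S'}\le\nu_S$, $\uplus$ adds multiplicities, $\varepsilon$ is the empty multiset; $\mathcal{M}^{(p)}(B)$ is the set of $S \in \mathcal{M}(B)$ with $|S|\le p$ (so $\mathcal{M}^{(-1)}(B)=\emptyset$). For $m\ge1$, an $m$-ary system of pointed multisets on $A$ is a pair $(\Phi,\Phi')$ with $\Phi\subseteq\mathcal{M}(A^m)$, $\Phi'\subseteq A^m\times\mathcal{M}(A^m)$ such that (1) $(x,S)\in\Phi'$ and $S'\subseteq S$ imply $(x,S')\in\Phi'$;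 (2) $(x,S)\in\Phi'$ implies $\{x\}\uplus S\in\Phi$. $\mathcal{W}_A$ is the set of all such systems, of all arities $m\ge1$. Inclusion, union and intersection of pairs are componentwise. A matrix $\mathbf{M}\in A^{m\times p}$, $p\ge0$, is a $p$-tuple of columns in $A^m$; $\mathbf{M}^*$ is its multiset of columns; $[\mathbf{M}_1|\mathbf{M}_2]$ is horizontal concatenation; for $f$ of arity $n$ and $\mathbf{M}_1\in A^{m\times n}$, $f\mathbf{M}_1\in A^m$ is obtained by applying $f$ to each row. For a set $\Phi$ of multisets on $A^m$, $\mathbf{M}\prec\Phi$ means $\mathbf{M}^*\in\Phi$; for a set $\Phi'$ of pointed multisets (pairs $(x,S) \in A^m\times\mathcal{M}(A^m)$) and $\mathbf{M}=(\mathbf{m}_1,\dots,\mathbf{m}_p)$ with $p\ge1$, $\mathbf{M}\prec\Phi'$ means $(\mathbf{m}_1,\{\mathbf{m}_2,\dots,\mathbf{m}_p\})\in\Phi'$. An $n$-ary $f$ preserves the $m$-ary system $(\Phi,\Phi')$ if for every matrix $\mathbf{M}=[\mathbf{M}_1|\mathbf{M}_2]$ with $m$ rows and finitely many columns, where $\mathbf{M}_1$ has $n$ columns and $\mathbf{M}_2$ may be empty, $\mathbf{M}\prec\Phi$ implies $[f\mathbf{M}_1|\mathbf{M}_2]\prec\Phi'$. Special systems. The $m$-ary trivial system of breadth $p\ge0$ is $\Omega_m^{(p)}:=(\mathcal{M}^{(p)}(A^m),\,A^m\times\mathcal{M}^{(p-1)}(A^m))$ (so $\Omega_m^{(0)}=(\{\varepsilon\},\emptyset)$).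 The $m$-ary empty system is $(\emptyset,\emptyset)$. The $m$-ary equality system is $(E_m,E'_m)$ with $E_m:=\{S\in\mathcal{M}(A^m)\mid \nu_S(a_1,\dots,a_m)\ne0\Rightarrow a_1=\dots=a_m\}$ and $E'_m:=\{(a,\dots,a)\in A^m\mid a\in A\}\times E_m$. Unary means $m=1$, binary $m=2$. Conjunctive minors. Integers are viewed as ordinals $m=\{0,\dots,m-1\}$ and tuples $\mathbf{a}\in A^m$ as maps $m\to A$. A minor formation scheme with target $m\ge1$, indeterminate set $V$ (an arbitrary, possibly empty, set disjoint from the ordinals) and source family $(n_j)_{j\in J}$ of positive integers is a nonempty family $H=(h_j)_{j\in J}$ of maps $h_j\colon n_j\to m\cup V$. For $\mathbf{a}\in A^m$ and $\sigma\in A^V$ (i.e. $\sigma\colon V\to A$), $(\mathbf{a}+\sigma)h_j\in A^{n_j}$ is the tuple whose $i$-th entry is $\mathbf{a}(h_j(i))$ if $h_j(i)\in m$ and $\sigma(h_j(i))$ if $h_j(i)\in V$. Let $(\Phi_j)_{j\in J}$ be a family of sets of multisets (resp. pointed multisets), $\Phi_j$ on $A^{n_j}$, and $\Phi$ a set of multisets (resp. pointed multisets) on $A^m$. For an $m\times n$ matrix $\mathbf{M}=(\mathbf{a}^1,\dots,\mathbf{a}^n)$ consider the condition $(\star)$ there exist $\sigma_1,\dots,\sigma_n\in A^V$ such that for all $j\in J$, $((\mathbf{a}^1+\sigma_1)h_j,\dots,(\mathbf{a}^n+\sigma_n)h_j)\prec\Phi_j$. $\Phi$ is a restrictive conjunctive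 minor of $(\Phi_j)_{j\in J}$ via $H$ if for every $n$ and every $m\times n$ matrix $\mathbf{M}$, $\mathbf{M}\prec\Phi$ implies $(\star)$; it is an extensive conjunctive minor via $H$ if for every such $\mathbf{M}$, $(\star)$ implies $\mathbf{M}\prec\Phi$. A system $(\Phi,\Phi')\in\mathcal{W}_A$ is a conjunctive minor of a family $(\Phi_j,\Phi'_j)_{j\in J}$ of systems if, for some scheme $H$, $\Phi$ is a restrictive conjunctive minor of $(\Phi_j)_{j\in J}$ via $H$ and $\Phi'$ is an extensive conjunctive minor of $(\Phi'_j)_{j\in J}$ via the same $H$. Quotients. For $S\in\mathcal{M}(A^m)$, $(\Phi,\Phi')/S:=(\Phi/S,\Phi'/S)$, where $\Phi/S:=\{S'\in\mathcal{M}(A^m)\mid S\uplus S'\in\Phi\}$ and $\Phi'/S:=\{(x,S')\in A^m\times\mathcal{M}(A^m)\mid (x,S\uplus S')\in\Phi'\}$. Restriction of breadth: for an $m$-ary system, $(\Phi,\Phi')^{(p)}:=(\Phi,\Phi')\cap\Omega_m^{(p)}$. Closure conditions. $\mathcal{W}\subseteq\mathcal{W}_A$ is: - closed under quotients, if $(\Phi,\Phi')\in\mathcal{W}$ implies that every quotient $(\Phi,\Phi')/S$ is in $\mathcal{W}$; - closed under dividends, if for every $(\Phi,\Phi')\in\mathcal{W}_A$, say of arity $m$, $(\Phi,\Phi')\in\mathcal{W}$ whenever (for some $p\ge0$) $\Omega_m^{(p)}\subseteq(\Phi,\Phi')$ and $(\Phi,\Phi')/S\in\mathcal{W}$ for every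 $S\in\mathcal{M}(A^m)$ with $|S|\ge p$; - locally closed, if $(\Phi,\Phi')\in\mathcal{W}$ whenever $(\Phi,\Phi')\in\mathcal{W}_A$ and $(\Phi,\Phi')^{(p)}\in\mathcal{W}$ for all $p\ge0$; - closed under unions, if $\bigcup_{j\in J}(\Phi_j,\Phi'_j)\in\mathcal{W}$ for every nonempty family $(\Phi_j,\Phi'_j)_{j\in J}$ of members of $\mathcal{W}$ of a common arity $m$; - closed under formation of conjunctive minors, if all conjunctive minors of nonempty families of members of $\mathcal{W}$ are in $\mathcal{W}$. *)

theory Defs
  imports "HOL-Library.Multiset" "HOL-Library.FuncSet"
begin

text \<open>
  The nonempty set \<open>A\<close> is the universe of a type \<open>'a\<close>.  Elements of \<open>A\<^sup>m\<close> are lists of length \<open>m\<close>,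
  and an \<open>m \<times> p\<close> matrix is the list of its \<open>p\<close> columns.
\<close>

definition tuples :: "nat \<Rightarrow> 'a list set" where
  "tuples m = {a. length a = m}"

definition multisets_on :: "'b set \<Rightarrow> 'b multiset set" where
  "multisets_on B = {S. set_mset S \<subseteq> B}"

text \<open>The bound is an integer because the bound \<open>-1\<close> (no multisets at all) occurs.\<close>

definition multisets_upto :: "int \<Rightarrow> 'b set \<Rightarrow> 'b multiset set" where
  "multisets_upto p B = {S \<in> multisets_on B. int (size S) \<le> p}"

definition operations :: "(nat \<times> ('a list \<Rightarrow> 'a)) set" where
  "operations = {(n, f). 1 \<le> n \<and> f \<in> tuples n \<rightarrow>\<^sub>E UNIV}"


text \<open>
  A system carries its arity explicitly: the empty system and the trivial system of breadth \<open>0\<close>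
  consist of the same two sets for every arity.
\<close>

datatype 'a pmsystem =
  System (arity: nat) (msets: "'a list multiset set") (pmsets: "('a list \<times> 'a list multiset) set")

definition systems :: "'a pmsystem set" where
  "systems = {s. 1 \<le> arity s \<and>
     msets s \<subseteq> multisets_on (tuples (arity s)) \<and>
     pmsets s \<subseteq> tuples (arity s) \<times> multisets_on (tuples (arity s)) \<and>
     (\<forall>x S S'. (x, S) \<in> pmsets s \<and> S' \<subseteq># S \<longrightarrow> (x, S') \<in> pmsets s) \<and>
     (\<forall>x S. (x, S) \<in> pmsets s \<longrightarrow> {#x#} + S \<in> msets s)}"

definition system_le :: "'a pmsystem \<Rightarrow> 'a pmsystem \<Rightarrow> bool" where
  "system_le s t \<longleftrightarrow> arity s = arity t \<and> msets s \<subseteq> msets t \<and> pmsets s \<subseteq> pmsets t"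

definition mat_prec :: "'b list \<Rightarrow> 'b multiset set \<Rightarrow> bool"  (infix \<open>\<prec>\<close> 50) where
  "M \<prec> \<Phi> \<longleftrightarrow> mset M \<in> \<Phi>"

text \<open>For pointed multisets the matrix must have at least one column.\<close>

definition mat_pprec :: "'b list \<Rightarrow> ('b \<times> 'b multiset) set \<Rightarrow> bool"  (infix \<open>\<prec>\<^sub>p\<close> 50) where
  "M \<prec>\<^sub>p \<Phi>' \<longleftrightarrow> M \<noteq> [] \<and> (hd M, mset (tl M)) \<in> \<Phi>'"

definition apply_rows :: "('a list \<Rightarrow> 'a) \<Rightarrow> nat \<Rightarrow> 'a list list \<Rightarrow> 'a list" where
  "apply_rows f m M = map (\<lambda>i. f (map (\<lambda>c. c ! i) M)) [0..<m]"

definition preserves :: "nat \<times> ('a list \<Rightarrow> 'a) \<Rightarrow> 'a pmsystem \<Rightarrow> bool" where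
  "preserves \<phi> s \<longleftrightarrow> (\<forall>M1 M2.
     set M1 \<subseteq> tuples (arity s) \<and> set M2 \<subseteq> tuples (arity s) \<and> length M1 = fst \<phi> \<and>
     M1 @ M2 \<prec> msets s \<longrightarrow> apply_rows (snd \<phi>) (arity s) M1 # M2 \<prec>\<^sub>p pmsets s)"


definition trivial_system :: "nat \<Rightarrow> nat \<Rightarrow> 'a pmsystem" where
  "trivial_system m p = System m (multisets_upto (int p) (tuples m))
     (tuples m \<times> multisets_upto (int p - 1) (tuples m))"

definition empty_system :: "nat \<Rightarrow> 'a pmsystem" where
  "empty_system m = System m {} {}"

definition equality_msets :: "nat \<Rightarrow> 'a list multiset set" where
  "equality_msets m =
     {S \<in> multisets_on (tuples m). \<forall>a. count S a \<noteq> 0 \<longrightarrow> (\<forall>i<m. \<forall>k<m. a ! i = a ! k)}"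

definition equality_system :: "nat \<Rightarrow> 'a pmsystem" where
  "equality_system m =
     System m (equality_msets m) (range (\<lambda>a. replicate m a) \<times> equality_msets m)"


text \<open>
  The disjoint union of the ordinal \<open>m\<close> and \<open>V\<close> is \<open>Inl ` {..<m} \<union> Inr ` V\<close>, and a map from
  \<open>n\<^sub>j\<close> to it is a list of length \<open>n\<^sub>j\<close>, just like a tuple.
\<close>

definition minor_scheme ::
    "nat \<Rightarrow> 'v set \<Rightarrow> 'j set \<Rightarrow> ('j \<Rightarrow> nat) \<Rightarrow> ('j \<Rightarrow> (nat + 'v) list) \<Rightarrow> bool" where
  "minor_scheme m V J n h \<longleftrightarrow> 1 \<le> m \<and> J \<noteq> {} \<and>
     (\<forall>j\<in>J. 1 \<le> n j \<and> length (h j) = n j \<and> set (h j) \<subseteq> Inl ` {..<m} \<union> Inr ` V)"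

definition scheme_apply :: "'a list \<Rightarrow> ('v \<Rightarrow> 'a) \<Rightarrow> (nat + 'v) list \<Rightarrow> 'a list" where
  "scheme_apply a \<sigma> h = map (case_sum (\<lambda>k. a ! k) \<sigma>) h"

text \<open>
  The argument \<open>R\<close> is one of the two relations \<open>\<prec>\<close> and \<open>\<prec>\<^sub>p\<close>.  The maps \<open>\<sigma> i\<close> are total on \<open>'v\<close>; for a
  scheme with indeterminate set \<open>V\<close> only their restrictions to \<open>V\<close> matter.
\<close>

definition minor_condition ::
    "('a list list \<Rightarrow> 'b \<Rightarrow> bool) \<Rightarrow> 'j set \<Rightarrow> ('j \<Rightarrow> (nat + 'v) list) \<Rightarrow> ('j \<Rightarrow> 'b) \<Rightarrow>
      'a list list \<Rightarrow> bool" where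
  "minor_condition R J h \<Psi> M \<longleftrightarrow> (\<exists>\<sigma>. \<forall>j\<in>J.
     R (map (\<lambda>i. scheme_apply (M ! i) (\<sigma> i) (h j)) [0..<length M]) (\<Psi> j))"

definition restrictive_minor ::
    "('a list list \<Rightarrow> 'b \<Rightarrow> bool) \<Rightarrow> nat \<Rightarrow> 'j set \<Rightarrow> ('j \<Rightarrow> (nat + 'v) list) \<Rightarrow> 'b \<Rightarrow> ('j \<Rightarrow> 'b) \<Rightarrow>
      bool" where
  "restrictive_minor R m J h \<Phi> \<Psi> \<longleftrightarrow>
     (\<forall>M. set M \<subseteq> tuples m \<and> R M \<Phi> \<longrightarrow> minor_condition R J h \<Psi> M)"

definition extensive_minor ::
    "('a list list \<Rightarrow> 'b \<Rightarrow> bool) \<Rightarrow> nat \<Rightarrow> 'j set \<Rightarrow> ('j \<Rightarrow> (nat + 'v) list) \<Rightarrow> 'b \<Rightarrow> ('j \<Rightarrow> 'b) \<Rightarrow>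
      bool" where
  "extensive_minor R m J h \<Phi> \<Psi> \<longleftrightarrow>
     (\<forall>M. set M \<subseteq> tuples m \<and> minor_condition R J h \<Psi> M \<longrightarrow> R M \<Phi>)"

definition conjunctive_minor_via ::
    "'v set \<Rightarrow> ('j \<Rightarrow> (nat + 'v) list) \<Rightarrow> 'j set \<Rightarrow> ('j \<Rightarrow> 'a pmsystem) \<Rightarrow> 'a pmsystem \<Rightarrow> bool" where
  "conjunctive_minor_via V h J t s \<longleftrightarrow>
     minor_scheme (arity s) V J (\<lambda>j. arity (t j)) h \<and>
     restrictive_minor (\<prec>) (arity s) J h (msets s) (\<lambda>j. msets (t j)) \<and>
     extensive_minor (\<prec>\<^sub>p) (arity s) J h (pmsets s) (\<lambda>j. pmsets (t j))"

definition closed_conjunctive_minors_in ::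
    "'j itself \<Rightarrow> 'v itself \<Rightarrow> 'a pmsystem set \<Rightarrow> bool" where
  "closed_conjunctive_minors_in _ _ W \<longleftrightarrow>
     (\<forall>(V :: 'v set) h (J :: 'j set) t s.
        J \<noteq> {} \<and> t ` J \<subseteq> W \<and> s \<in> systems \<and> conjunctive_minor_via V h J t s \<longrightarrow> s \<in> W)"

text \<open>
  Index sets \<open>J\<close> and indeterminate sets \<open>V\<close> are arbitrary sets, but HOL cannot quantify over all types
  inside a definition.  Two types depending only on \<open>'a\<close> are fixed instead.  Nothing is lost: by
  \<open>closed_conjunctive_minors_imp_in\<close> below, closure for these two types implies closure for
  all index types and all indeterminate types.
\<close>

type_synonym 'a indet = "'a list list \<times> nat \<Rightarrow> 'a"

type_synonym 'a minor_index = "'a pmsystem \<times> (nat + 'a indet) list"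

definition closed_conjunctive_minors :: "'a pmsystem set \<Rightarrow> bool" where
  "closed_conjunctive_minors W \<longleftrightarrow>
     closed_conjunctive_minors_in TYPE('a minor_index) TYPE('a indet) W"

lemma scheme_apply_map_sum:
  "scheme_apply a \<sigma> (map (map_sum id q) h) = scheme_apply a (\<lambda>v. \<sigma> (q v)) h"
  by (auto simp: scheme_apply_def split: sum.splits)

lemma conjunctive_minor_canonical:
  fixes V :: "'v set" and J :: "'j set" and t :: "'j \<Rightarrow> 'a pmsystem"
  assumes "conjunctive_minor_via V h J t s"
  obtains V' :: "'a indet set" and J' :: "'a minor_index set"
    where "J' \<noteq> {}" "fst ` J' = t ` J" "conjunctive_minor_via V' snd J' fst s"
proof -
  have sch: "minor_scheme (arity s) V J (\<lambda>j. arity (t j)) h"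
    and res: "restrictive_minor (\<prec>) (arity s) J h (msets s) (\<lambda>j. msets (t j))"
    and ext: "extensive_minor (\<prec>\<^sub>p) (arity s) J h (pmsets s) (\<lambda>j. pmsets (t j))"
    using assms by (auto simp: conjunctive_minor_via_def)
  from res have "\<forall>M. \<exists>\<sigma>. set M \<subseteq> tuples (arity s) \<and> M \<prec> msets s \<longrightarrow>
      (\<forall>j\<in>J. map (\<lambda>i. scheme_apply (M ! i) (\<sigma> i) (h j)) [0..<length M] \<prec> msets (t j))"
    unfolding restrictive_minor_def minor_condition_def by blast
  then obtain \<tau> where \<tau>: "\<And>M j. set M \<subseteq> tuples (arity s) \<Longrightarrow> M \<prec> msets s \<Longrightarrow> j \<in> J \<Longrightarrow>
      map (\<lambda>i. scheme_apply (M ! i) (\<tau> M i) (h j)) [0..<length M] \<prec> msets (t j)"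
    by metis
  define q :: "'v \<Rightarrow> 'a indet" where "q v = (\<lambda>(M, i). \<tau> M i v)" for v
  define g where "g j = (t j, map (map_sum id q) (h j))" for j
  have "minor_scheme (arity s) (q ` V) (g ` J) (\<lambda>j. arity (fst j)) snd"
    unfolding minor_scheme_def
  proof (intro conjI ballI)
    fix k assume "k \<in> g ` J"
    then obtain j where j: "j \<in> J" "k = g j"
      by auto
    show "1 \<le> arity (fst k)" "length (snd k) = arity (fst k)"
      using sch j by (auto simp: minor_scheme_def g_def)
    have "map_sum id q x \<in> Inl ` {..<arity s} \<union> Inr ` q ` V" if "x \<in> set (h j)" for x
    proof -
      have "x \<in> Inl ` {..<arity s} \<union> Inr ` V"
        using sch j that by (auto simp: minor_scheme_def)
      then show ?thesis
        by auto
    qed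
    then show "set (snd k) \<subseteq> Inl ` {..<arity s} \<union> Inr ` q ` V"
      using j by (auto simp: g_def)
  qed (use sch in \<open>auto simp: minor_scheme_def\<close>)
  moreover have "restrictive_minor (\<prec>) (arity s) (g ` J) snd (msets s) (\<lambda>j. msets (fst j))"
    unfolding restrictive_minor_def minor_condition_def
  proof (intro allI impI, elim conjE)
    fix M assume "set M \<subseteq> tuples (arity s)" "M \<prec> msets s"
    then show "\<exists>\<sigma>. \<forall>j\<in>g ` J.
        map (\<lambda>i. scheme_apply (M ! i) (\<sigma> i) (snd j)) [0..<length M] \<prec> msets (fst j)"
      by (intro exI[of _ "\<lambda>i w. w (M, i)"])
        (simp add: g_def scheme_apply_map_sum q_def \<tau>)
  qed
  moreover have "extensive_minor (\<prec>\<^sub>p) (arity s) (g ` J) snd (pmsets s) (\<lambda>j. pmsets (fst j))"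
    unfolding extensive_minor_def
  proof (intro allI impI, elim conjE)
    fix M assume M: "set M \<subseteq> tuples (arity s)"
      and "minor_condition (\<prec>\<^sub>p) (g ` J) snd (\<lambda>j. pmsets (fst j)) M"
    then obtain \<sigma> where "\<forall>j\<in>J.
        map (\<lambda>i. scheme_apply (M ! i) (\<lambda>v. \<sigma> i (q v)) (h j)) [0..<length M] \<prec>\<^sub>p pmsets (t j)"
      by (auto simp: minor_condition_def g_def scheme_apply_map_sum)
    then have "minor_condition (\<prec>\<^sub>p) J h (\<lambda>j. pmsets (t j)) M"
      unfolding minor_condition_def by (intro exI[of _ "\<lambda>i v. \<sigma> i (q v)"])
    with M ext show "M \<prec>\<^sub>p pmsets s"
      by (auto simp: extensive_minor_def)
  qed
  ultimately have via: "conjunctive_minor_via (q ` V) snd (g ` J) fst s"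
    by (simp add: conjunctive_minor_via_def)
  show thesis
  proof (rule that)
    show "g ` J \<noteq> {}"
      using sch by (simp add: minor_scheme_def)
    show "fst ` g ` J = t ` J"
      by (simp add: g_def image_image)
  qed (rule via)
qed

lemma closed_conjunctive_minors_imp_in:
  fixes W :: "'a pmsystem set"
  assumes "closed_conjunctive_minors W"
  shows "closed_conjunctive_minors_in TYPE('j) TYPE('v) W"
  unfolding closed_conjunctive_minors_in_def
proof (intro allI impI, elim conjE)
  fix V :: "'v set" and h and J :: "'j set" and t and s
  assume tW: "t ` J \<subseteq> W" and s: "s \<in> systems" and via: "conjunctive_minor_via V h J t s"
  obtain V' :: "'a indet set" and J' :: "'a minor_index set"
    where "J' \<noteq> {}" "fst ` J' = t ` J" "conjunctive_minor_via V' snd J' fst s"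
    by (rule conjunctive_minor_canonical[OF via])
  moreover from this have "fst ` J' \<subseteq> W"
    using tW by simp
  ultimately show "s \<in> W"
    using s assms[unfolded closed_conjunctive_minors_def closed_conjunctive_minors_in_def,
        THEN spec, of V', THEN spec, of snd, THEN spec, of J', THEN spec, of fst, THEN spec, of s]
    by simp
qed


definition system_quotient :: "'a pmsystem \<Rightarrow> 'a list multiset \<Rightarrow> 'a pmsystem" where
  "system_quotient s S = System (arity s)
     {S' \<in> multisets_on (tuples (arity s)). S + S' \<in> msets s}
     {(x, S') \<in> tuples (arity s) \<times> multisets_on (tuples (arity s)). (x, S + S') \<in> pmsets s}"

definition restrict_breadth :: "'a pmsystem \<Rightarrow> nat \<Rightarrow> 'a pmsystem" where
  "restrict_breadth s p = System (arity s)
     (msets s \<inter> msets (trivial_system (arity s) p))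
     (pmsets s \<inter> pmsets (trivial_system (arity s) p))"

definition closed_quotients :: "'a pmsystem set \<Rightarrow> bool" where
  "closed_quotients W \<longleftrightarrow>
     (\<forall>s\<in>W. \<forall>S\<in>multisets_on (tuples (arity s)). system_quotient s S \<in> W)"

definition closed_dividends :: "'a pmsystem set \<Rightarrow> bool" where
  "closed_dividends W \<longleftrightarrow> (\<forall>s\<in>systems.
     (\<exists>p. system_le (trivial_system (arity s) p) s \<and>
          (\<forall>S\<in>multisets_on (tuples (arity s)). p \<le> size S \<longrightarrow> system_quotient s S \<in> W)) \<longrightarrow> s \<in> W)"

definition locally_closed :: "'a pmsystem set \<Rightarrow> bool" where
  "locally_closed W \<longleftrightarrow> (\<forall>s\<in>systems. (\<forall>p. restrict_breadth s p \<in> W) \<longrightarrow> s \<in> W)"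

text \<open>The union of a family depends only on its range, so families are given as sets of systems.\<close>

definition closed_unions :: "'a pmsystem set \<Rightarrow> bool" where
  "closed_unions W \<longleftrightarrow> (\<forall>m G. G \<noteq> {} \<and> G \<subseteq> W \<and> (\<forall>s\<in>G. arity s = m) \<longrightarrow>
     System m (\<Union>s\<in>G. msets s) (\<Union>s\<in>G. pmsets s) \<in> W)"

definition characterized_by :: "'a pmsystem set \<Rightarrow> (nat \<times> ('a list \<Rightarrow> 'a)) set \<Rightarrow> bool" where
  "characterized_by W F \<longleftrightarrow> W = {s \<in> systems. \<forall>\<phi>\<in>F. preserves \<phi> s}"

end

theory Submission
  imports Defs
begin

text \<open>
  Preservation by an operation passes through each closure operation by a direct computation; the
  substance is the converse, where the characterizing operations can only be all operations that
  preserve every member of \<open>W\<close> (\<open>polymorphisms W\<close>).  So let \<open>s\<close> be preserved by all of them; the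
  claim is \<open>s \<in> W\<close> (\<open>mem_if_preserved\<close>).

  For an \<open>m \<times> n\<close> matrix \<open>N\<close>, take all \<open>n\<close>-tuples as indeterminates.  An assignment of values to
  them is an \<open>n\<close>-ary operation, and the requirement that it maps every \<open>n\<close>-column matrix allowed by a
  member of \<open>W\<close> into that member is a conjunction of conditions of the kind that conjunctive
  minors express.  Binary equality systems force the target column to be the value of the operation on
  the rows of \<open>N\<close>.  The resulting minor, the free system of \<open>N\<close>, belongs to \<open>W\<close>
  (\<open>free_system_mem\<close>).  It may contain \<open>N\<close> because the projections solve all conditions on the
  columns of \<open>N\<close>; and in each of its pairs \<open>(x, S)\<close> the column \<open>x\<close> is the value at \<open>N\<close> of an
  operation preserving \<open>W\<close>, since additional columns can be absorbed into quotients
  (\<open>free_solution_operation\<close>).  This controls the pairs \<open>(x, {#})\<close> but not the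
  pairs \<open>(x, S)\<close> with nonempty \<open>S\<close>.

  The latter are controlled when the union of \<open>s\<close> with the trivial system of breadth one is already
  in \<open>W\<close>, because that union then takes part in the conditions.  In this case all free systems of
  matrices of \<open>s\<close> lie below \<open>s\<close>, and \<open>s\<close> arises from their union by enlarging the set of
  pointed multisets (\<open>mem_if_union_breadth_one_mem\<close>).  The general case is reduced to this one: by
  local closure \<open>s\<close> may be assumed to have breadth at most some \<open>p\<close>; its union with the trivial
  system of breadth \<open>p\<close> is trivial and hence in \<open>W\<close>; and closure under dividends allows the breadth
  of the adjoined trivial system to be lowered one by one, the quotients that matter being exactly
  of the special kind just treated (\<open>union_trivial_step\<close>).
\<close>

section \<open>Multiset forms of preservation and of the minor condition\<close>

lemma list_preimage_of_image_mset:
  assumes "image_mset f T = mset M"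
  shows "\<exists>L. mset L = T \<and> map f L = M"
  using assms
proof (induction M arbitrary: T)
  case Nil
  then show ?case by simp
next
  case (Cons a M)
  then have "image_mset f T = add_mset a (mset M)" by simp
  then obtain T' z where T: "T = add_mset z T'" "f z = a" "image_mset f T' = mset M"
    using msed_map_invR by metis
  then obtain L where "mset L = T'" "map f L = M"
    using Cons.IH by blast
  with T show ?case by (intro exI[of _ "z # L"]) simp
qed

lemma systemsD:
  assumes "s \<in> systems"
  shows "1 \<le> arity s"
    and "S \<in> msets s \<Longrightarrow> S \<in> multisets_on (tuples (arity s))"
    and "(x, S) \<in> pmsets s \<Longrightarrow> x \<in> tuples (arity s)"
    and "(x, S) \<in> pmsets s \<Longrightarrow> S \<in> multisets_on (tuples (arity s))"
    and "(x, S) \<in> pmsets s \<Longrightarrow> S' \<subseteq># S \<Longrightarrow> (x, S') \<in> pmsets s"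
    and "(x, S) \<in> pmsets s \<Longrightarrow> add_mset x S \<in> msets s"
  using assms unfolding systems_def by auto

lemma systemsI:
  assumes "1 \<le> arity s"
    and "\<And>S. S \<in> msets s \<Longrightarrow> S \<in> multisets_on (tuples (arity s))"
    and "\<And>x S. (x, S) \<in> pmsets s \<Longrightarrow>
           x \<in> tuples (arity s) \<and> S \<in> multisets_on (tuples (arity s)) \<and> add_mset x S \<in> msets s"
    and "\<And>x S S'. (x, S) \<in> pmsets s \<Longrightarrow> S' \<subseteq># S \<Longrightarrow> (x, S') \<in> pmsets s"
  shows "s \<in> systems"
  using assms unfolding systems_def by auto

lemma multisets_on_plus [simp]:
  "S + S' \<in> multisets_on B \<longleftrightarrow> S \<in> multisets_on B \<and> S' \<in> multisets_on B"
  by (auto simp: multisets_on_def)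

lemma multisets_on_add_mset [simp]:
  "add_mset x S \<in> multisets_on B \<longleftrightarrow> x \<in> B \<and> S \<in> multisets_on B"
  by (auto simp: multisets_on_def)

lemma multisets_on_empty [simp]: "{#} \<in> multisets_on B"
  by (simp add: multisets_on_def)

lemma multisets_on_mset [simp]: "mset M \<in> multisets_on B \<longleftrightarrow> set M \<subseteq> B"
  by (simp add: multisets_on_def)

lemma multisets_on_subset: "S' \<subseteq># S \<Longrightarrow> S \<in> multisets_on B \<Longrightarrow> S' \<in> multisets_on B"
  by (auto simp: multisets_on_def dest: set_mset_mono)

lemma apply_rows_in_tuples [simp]: "apply_rows f m M \<in> tuples m"
  by (simp add: apply_rows_def tuples_def)

lemma preserves_multiset_iff:
  assumes s: "s \<in> systems"
  shows "preserves \<phi> s \<longleftrightarrow> (\<forall>M S. length M = fst \<phi> \<and> mset M + S \<in> msets s \<longrightarrow>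
           (apply_rows (snd \<phi>) (arity s) M, S) \<in> pmsets s)"
    (is "_ \<longleftrightarrow> ?R")
proof
  assume P: "preserves \<phi> s"
  show ?R
  proof (intro allI impI, elim conjE)
    fix M S assume M: "length M = fst \<phi>" "mset M + S \<in> msets s"
    obtain M2 where M2: "mset M2 = S" using ex_mset by blast
    have "mset M + S \<in> multisets_on (tuples (arity s))"
      using systemsD(2)[OF s] M(2) by blast
    with M M2 P show "(apply_rows (snd \<phi>) (arity s) M, S) \<in> pmsets s"
      unfolding preserves_def mat_prec_def mat_pprec_def by (auto simp del: apply_rows_in_tuples)
  qed
qed (auto simp: preserves_def mat_prec_def mat_pprec_def)

text \<open>
  A column together with its own values of the indeterminates: carrying the two as a pair turns the
  family of assignments in the minor condition into a multiset, so that the condition can be split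
  and restricted along with the multiset of columns.
\<close>

definition pull_column :: "(nat + 'v) list \<Rightarrow> 'a list \<times> ('v \<Rightarrow> 'a) \<Rightarrow> 'a list" where
  "pull_column h z = scheme_apply (fst z) (snd z) h"

lemma minor_condition_pairs:
  "minor_condition R J h \<Psi> M \<longleftrightarrow>
     (\<exists>L. map fst L = M \<and> (\<forall>j\<in>J. R (map (pull_column (h j)) L) (\<Psi> j)))"
    (is "_ \<longleftrightarrow> ?R")
proof
  assume "minor_condition R J h \<Psi> M"
  then obtain \<sigma> where \<sigma>:
    "\<forall>j\<in>J. R (map (\<lambda>i. scheme_apply (M ! i) (\<sigma> i) (h j)) [0..<length M]) (\<Psi> j)"
    unfolding minor_condition_def by blast
  let ?L = "map (\<lambda>i. (M ! i, \<sigma> i)) [0..<length M]"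
  have "map fst ?L = M" by (simp add: map_nth comp_def)
  moreover have "map (pull_column (h j)) ?L
      = map (\<lambda>i. scheme_apply (M ! i) (\<sigma> i) (h j)) [0..<length M]" for j
    by (simp add: pull_column_def)
  ultimately show ?R using \<sigma> by (intro exI[of _ ?L]) (simp only: simp_thms)
next
  assume ?R
  then obtain L where L: "map fst L = M" "\<forall>j\<in>J. R (map (pull_column (h j)) L) (\<Psi> j)"
    by blast
  have "map (\<lambda>i. scheme_apply (M ! i) (snd (L ! i)) (h j)) [0..<length M]
      = map (pull_column (h j)) L" for j
    unfolding L(1)[symmetric] by (rule nth_equalityI) (simp_all add: pull_column_def)
  with L(2) show "minor_condition R J h \<Psi> M"
    unfolding minor_condition_def by (intro exI[of _ "\<lambda>i. snd (L ! i)"]) simp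
qed

lemma minor_condition_mset_iff:
  "minor_condition (\<prec>) J h \<Psi> M \<longleftrightarrow>
     (\<exists>T. image_mset fst T = mset M \<and> (\<forall>j\<in>J. image_mset (pull_column (h j)) T \<in> \<Psi> j))"
    (is "_ \<longleftrightarrow> ?R")
proof
  assume "minor_condition (\<prec>) J h \<Psi> M"
  then obtain L where L: "map fst L = M" "\<forall>j\<in>J. map (pull_column (h j)) L \<prec> \<Psi> j"
    unfolding minor_condition_pairs by (elim exE conjE)
  have "image_mset (pull_column (h j)) (mset L) \<in> \<Psi> j" if "j \<in> J" for j
    using L(2) that by (simp add: mat_prec_def)
  with L(1) show ?R
    by (intro exI[of _ "mset L"]) (simp flip: mset_map)
next
  assume ?R
  then obtain T where T: "image_mset fst T = mset M"
      "\<forall>j\<in>J. image_mset (pull_column (h j)) T \<in> \<Psi> j"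
    by (elim exE conjE)
  obtain L where L: "mset L = T" "map fst L = M"
    using list_preimage_of_image_mset[OF T(1)] by (elim exE conjE)
  have "map (pull_column (h j)) L \<prec> \<Psi> j" if "j \<in> J" for j
    using T(2) that L(1) by (simp add: mat_prec_def)
  with L(2) show "minor_condition (\<prec>) J h \<Psi> M"
    unfolding minor_condition_pairs by (intro exI[of _ L]) simp
qed

lemma minor_condition_pointed_iff:
  "minor_condition (\<prec>\<^sub>p) J h \<Psi> (x # M) \<longleftrightarrow>
     (\<exists>y T. fst y = x \<and> image_mset fst T = mset M \<and>
        (\<forall>j\<in>J. (pull_column (h j) y, image_mset (pull_column (h j)) T) \<in> \<Psi> j))"
    (is "_ \<longleftrightarrow> ?R")
proof
  assume "minor_condition (\<prec>\<^sub>p) J h \<Psi> (x # M)"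
  then obtain L where L: "map fst L = x # M"
      "\<forall>j\<in>J. map (pull_column (h j)) L \<prec>\<^sub>p \<Psi> j"
    unfolding minor_condition_pairs by (elim exE conjE)
  from L(1) obtain y K where K: "L = y # K" "fst y = x" "map fst K = M"
    by (auto simp: map_eq_Cons_conv)
  have "(pull_column (h j) y, image_mset (pull_column (h j)) (mset K)) \<in> \<Psi> j" if "j \<in> J" for j
    using L(2) that K(1) by (simp add: mat_pprec_def)
  with K(2,3) show ?R
    by (intro exI[of _ y] exI[of _ "mset K"]) (simp flip: mset_map)
next
  assume ?R
  then obtain y T where T: "fst y = x" "image_mset fst T = mset M"
      "\<forall>j\<in>J. (pull_column (h j) y, image_mset (pull_column (h j)) T) \<in> \<Psi> j"
    by (elim exE conjE)
  obtain L where L: "mset L = T" "map fst L = M"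
    using list_preimage_of_image_mset[OF T(2)] by blast
  have "map (pull_column (h j)) (y # L) \<prec>\<^sub>p \<Psi> j" if "j \<in> J" for j
    using T(3) that L(1) by (simp add: mat_pprec_def)
  moreover have "map fst (y # L) = x # M"
    using T(1) L(2) by simp
  ultimately show "minor_condition (\<prec>\<^sub>p) J h \<Psi> (x # M)"
    unfolding minor_condition_pairs by (intro exI[of _ "y # L"]) simp
qed

text \<open>
  Both halves of a conjunctive minor in terms of multisets of pairs.  Only matrices with at least one
  column matter for the extensive half: the family is nonempty, so a matrix without columns never
  satisfies the pointed condition.
\<close>

lemma conjunctive_minor_via_multisets:
  fixes h :: "'j \<Rightarrow> (nat + 'v) list" and s :: "'a pmsystem"
  assumes s: "s \<in> systems"
    and scheme: "minor_scheme (arity s) V J (\<lambda>j. arity (t j)) h"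
    and res: "\<And>S. S \<in> msets s \<Longrightarrow>
      \<exists>T. image_mset fst T = S \<and> (\<forall>j\<in>J. image_mset (pull_column (h j)) T \<in> msets (t j))"
    and ext: "\<And>y T. fst y \<in> tuples (arity s) \<Longrightarrow>
      image_mset fst T \<in> multisets_on (tuples (arity s)) \<Longrightarrow>
      (\<And>j. j \<in> J \<Longrightarrow> (pull_column (h j) y, image_mset (pull_column (h j)) T) \<in> pmsets (t j)) \<Longrightarrow>
      (fst y, image_mset fst T) \<in> pmsets s"
  shows "conjunctive_minor_via V h J t s"
  unfolding conjunctive_minor_via_def
proof (intro conjI)
  show "restrictive_minor (\<prec>) (arity s) J h (msets s) (\<lambda>j. msets (t j))"
    unfolding restrictive_minor_def minor_condition_mset_iff mat_prec_def
    by (intro allI impI res) (rule conjunct2)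
  show "extensive_minor (\<prec>\<^sub>p) (arity s) J h (pmsets s) (\<lambda>j. pmsets (t j))"
    unfolding extensive_minor_def
  proof (intro allI impI, elim conjE)
    fix M assume M: "set M \<subseteq> tuples (arity s)"
      and c: "minor_condition (\<prec>\<^sub>p) J h (\<lambda>j. pmsets (t j)) M"
    have "J \<noteq> {}" using scheme by (simp add: minor_scheme_def)
    with c have "M \<noteq> []"
      by (auto simp: minor_condition_def mat_pprec_def)
    then obtain x K where K: "M = x # K" by (cases M) auto
    from c K obtain y T where yT: "fst y = x" "image_mset fst T = mset K"
      "\<forall>j\<in>J. (pull_column (h j) y, image_mset (pull_column (h j)) T) \<in> pmsets (t j)"
      unfolding K minor_condition_pointed_iff by (elim exE conjE)
    have "(fst y, image_mset fst T) \<in> pmsets s"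
      by (rule ext) (use yT M K in auto)
    with yT K show "M \<prec>\<^sub>p pmsets s" by (simp add: mat_pprec_def)
  qed
qed (rule scheme)


section \<open>Constructions of systems\<close>

definition system_union :: "'a pmsystem \<Rightarrow> 'a pmsystem \<Rightarrow> 'a pmsystem" where
  "system_union s t = System (arity s) (msets s \<union> msets t) (pmsets s \<union> pmsets t)"

lemma system_union_sel [simp]:
  "arity (system_union s t) = arity s"
  "msets (system_union s t) = msets s \<union> msets t"
  "pmsets (system_union s t) = pmsets s \<union> pmsets t"
  by (simp_all add: system_union_def)

lemma trivial_system_sel [simp]:
  "arity (trivial_system m p) = m"
  "S \<in> msets (trivial_system m p) \<longleftrightarrow> S \<in> multisets_on (tuples m) \<and> size S \<le> p"
  "(x, S) \<in> pmsets (trivial_system m p) \<longleftrightarrow>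
     x \<in> tuples m \<and> S \<in> multisets_on (tuples m) \<and> size S < p"
  by (auto simp: trivial_system_def multisets_upto_def)

lemma quotient_sel [simp]:
  "arity (system_quotient s S) = arity s"
  "S' \<in> msets (system_quotient s S) \<longleftrightarrow>
     S' \<in> multisets_on (tuples (arity s)) \<and> S + S' \<in> msets s"
  "(x, S') \<in> pmsets (system_quotient s S) \<longleftrightarrow>
     x \<in> tuples (arity s) \<and> S' \<in> multisets_on (tuples (arity s)) \<and> (x, S + S') \<in> pmsets s"
  by (simp_all add: system_quotient_def)

lemma trivial_system_in_systems: "1 \<le> m \<Longrightarrow> trivial_system m p \<in> systems"
proof (rule systemsI, goal_cases)
  case (4 x S S')
  then show ?case
    by (auto intro: multisets_on_subset dest: size_mset_mono)
qed auto

lemma equality_msets_subset: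
  assumes "S' \<subseteq># S" "S \<in> equality_msets m"
  shows "S' \<in> equality_msets m"
proof -
  have "count S a \<noteq> 0" if "count S' a \<noteq> 0" for a
    using mset_subset_eq_count[OF assms(1), of a] that by linarith
  moreover have "S' \<in> multisets_on (tuples m)"
    using assms multisets_on_subset unfolding equality_msets_def by blast
  ultimately show ?thesis
    using assms(2) unfolding equality_msets_def by blast
qed

lemma equality_system_in_systems: "1 \<le> m \<Longrightarrow> equality_system m \<in> systems"
proof (rule systemsI, goal_cases)
  case (4 x S S')
  then show ?case
    by (auto simp: equality_system_def intro: equality_msets_subset)
next
  case (3 x S)
  then obtain b where x: "x = replicate m b" and S: "S \<in> equality_msets m"
    by (auto simp: equality_system_def)
  have on: "S \<in> multisets_on (tuples m)"
    using S unfolding equality_msets_def by blast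
  have "\<forall>i<m. \<forall>k<m. a ! i = a ! k" if "count (add_mset x S) a \<noteq> 0" for a
  proof (cases "a = x")
    case True
    then show ?thesis using x by simp
  next
    case False
    then have "count S a \<noteq> 0" using that by simp
    then show ?thesis using S unfolding equality_msets_def by blast
  qed
  moreover have "x \<in> tuples m"
    using x by (simp add: tuples_def)
  moreover from this have "add_mset x S \<in> multisets_on (tuples m)"
    using on by simp
  ultimately have "x \<in> tuples m" "add_mset x S \<in> equality_msets m"
    unfolding equality_msets_def by blast+
  with on show ?case by (simp add: equality_system_def)
next
  case (2 S)
  then show ?case unfolding equality_system_def equality_msets_def pmsystem.sel by blast
qed (simp add: equality_system_def)

lemma empty_system_in_systems: "1 \<le> m \<Longrightarrow> empty_system m \<in> systems"
  by (rule systemsI) (auto simp: empty_system_def)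

lemma Union_in_systems:
  assumes G: "G \<noteq> {}" "G \<subseteq> systems" "\<forall>s\<in>G. arity s = m"
  shows "System m (\<Union>s\<in>G. msets s) (\<Union>s\<in>G. pmsets s) \<in> systems"
proof (rule systemsI, goal_cases)
  case 1
  obtain s where "s \<in> G" using G(1) by blast
  with G(2,3) systemsD(1)[of s] show ?case by auto
next
  case (2 S)
  then obtain s where s: "s \<in> G" "S \<in> msets s" by auto
  then have "s \<in> systems" "arity s = m" using G by auto
  with systemsD(2)[of s, OF _ s(2)] show ?case by simp
next
  case (3 x S)
  then obtain s where s: "s \<in> G" "(x, S) \<in> pmsets s" by auto
  then have "s \<in> systems" "arity s = m" using G by auto
  with systemsD(3,4,6)[of s, OF _ s(2)] s(1) show ?case by auto
next
  case (4 x S S')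
  then obtain s where s: "s \<in> G" "(x, S) \<in> pmsets s" by auto
  then have "s \<in> systems" using G by auto
  from systemsD(5)[OF this s(2) 4(2)] s(1) show ?case by auto
qed

lemma union_in_systems:
  assumes "s \<in> systems" "t \<in> systems" "arity s = arity t"
  shows "system_union s t \<in> systems"
  using Union_in_systems[of "{s, t}" "arity s"] assms by (simp add: system_union_def)

lemma quotient_in_systems:
  assumes s: "s \<in> systems"
  shows "system_quotient s S \<in> systems"
proof (rule systemsI, goal_cases)
  case (3 x S')
  then show ?case using systemsD(6)[OF s, of x "S + S'"] by auto
next
  case (4 x S1 S2)
  have "S + S2 \<subseteq># S + S1" using 4(2) by simp
  with 4 show ?case
    using systemsD(5)[OF s] multisets_on_subset by auto
qed (use systemsD(1)[OF s] in auto)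

lemma restrict_breadth_sel [simp]:
  "arity (restrict_breadth s p) = arity s"
  "msets (restrict_breadth s p) = msets s \<inter> msets (trivial_system (arity s) p)"
  "pmsets (restrict_breadth s p) = pmsets s \<inter> pmsets (trivial_system (arity s) p)"
  by (simp_all add: restrict_breadth_def)

lemma restrict_breadth_in_systems:
  assumes s: "s \<in> systems"
  shows "restrict_breadth s p \<in> systems"
proof (rule systemsI, goal_cases)
  case 1
  then show ?case using systemsD(1)[OF s] by simp
next
  case (4 x S S')
  then show ?case
    using systemsD(5)[OF s] systemsD(5)[OF trivial_system_in_systems[OF systemsD(1)[OF s]], of x S p S']
    by auto
qed (use systemsD[OF s] in auto)


section \<open>Systems preserved by an operation\<close>

lemma preserves_multisetI:
  assumes "s \<in> systems"
    and "\<And>M S. length M = fst \<phi> \<Longrightarrow> mset M + S \<in> msets s \<Longrightarrow>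
           (apply_rows (snd \<phi>) (arity s) M, S) \<in> pmsets s"
  shows "preserves \<phi> s"
  using assms by (simp add: preserves_multiset_iff)

lemma preserves_multisetD:
  assumes "preserves \<phi> s" "s \<in> systems" "length M = fst \<phi>" "mset M + S \<in> msets s"
  shows "(apply_rows (snd \<phi>) (arity s) M, S) \<in> pmsets s"
  using assms by (simp add: preserves_multiset_iff)

lemma preserves_trivial_system:
  assumes "1 \<le> fst \<phi>" "1 \<le> m"
  shows "preserves \<phi> (trivial_system m p)"
  by (rule preserves_multisetI[OF trivial_system_in_systems[OF assms(2)]]) (use assms(1) in simp)

lemma preserves_empty_system: "1 \<le> m \<Longrightarrow> preserves \<phi> (empty_system m)"
  by (rule preserves_multisetI[OF empty_system_in_systems]) (simp_all add: empty_system_def)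

lemma preserves_Union:
  assumes G: "G \<noteq> {}" "G \<subseteq> systems" "\<forall>s\<in>G. arity s = m" and pr: "\<forall>s\<in>G. preserves \<phi> s"
  shows "preserves \<phi> (System m (\<Union>s\<in>G. msets s) (\<Union>s\<in>G. pmsets s))"
proof (rule preserves_multisetI[OF Union_in_systems[OF G]])
  fix M S
  assume len: "length M = fst \<phi>"
    and "mset M + S \<in> msets (System m (\<Union>s\<in>G. msets s) (\<Union>s\<in>G. pmsets s))"
  then obtain s where s: "s \<in> G" "mset M + S \<in> msets s" by auto
  then have "s \<in> systems" "arity s = m" "preserves \<phi> s" using G pr by auto
  with preserves_multisetD[of \<phi> s, OF _ _ len s(2)] s(1)
  show "(apply_rows (snd \<phi>) (arity (System m (\<Union>s\<in>G. msets s) (\<Union>s\<in>G. pmsets s))) M, S)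
      \<in> pmsets (System m (\<Union>s\<in>G. msets s) (\<Union>s\<in>G. pmsets s))"
    by auto
qed

lemma preserves_union:
  assumes "s \<in> systems" "t \<in> systems" "arity s = arity t" "preserves \<phi> s" "preserves \<phi> t"
  shows "preserves \<phi> (system_union s t)"
  using preserves_Union[of "{s, t}" "arity s" \<phi>] assms by (simp add: system_union_def)

lemma preserves_quotient:
  assumes s: "s \<in> systems" and pr: "preserves \<phi> s"
  shows "preserves \<phi> (system_quotient s S)"
proof (rule preserves_multisetI[OF quotient_in_systems[OF s]])
  fix M T assume M: "length M = fst \<phi>" "mset M + T \<in> msets (system_quotient s S)"
  then have "mset M + (S + T) \<in> msets s" by (simp add: ac_simps)
  from preserves_multisetD[OF pr s M(1) this] M(2)
  show "(apply_rows (snd \<phi>) (arity (system_quotient s S)) M, T) \<in> pmsets (system_quotient s S)"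
    by simp
qed

lemma preserves_restrict_breadth:
  assumes s: "s \<in> systems" and pr: "preserves \<phi> s" and n: "1 \<le> fst \<phi>"
  shows "preserves \<phi> (restrict_breadth s p)"
proof (rule preserves_multisetI[OF restrict_breadth_in_systems[OF s]])
  fix M S assume M: "length M = fst \<phi>" "mset M + S \<in> msets (restrict_breadth s p)"
  then have "mset M + S \<in> msets s" by simp
  from preserves_multisetD[OF pr s M(1) this] M n
  show "(apply_rows (snd \<phi>) (arity (restrict_breadth s p)) M, S) \<in> pmsets (restrict_breadth s p)"
    by simp
qed

lemma preserves_equality_system:
  fixes \<phi> :: "nat \<times> ('a list \<Rightarrow> 'a)"
  shows "preserves \<phi> (equality_system 2)"
proof (rule preserves_multisetI[OF equality_system_in_systems[OF one_le_numeral]])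
  fix M and S :: "'a list multiset" assume "mset M + S \<in> msets (equality_system 2)"
  then have MS: "mset M + S \<in> equality_msets 2"
    by (simp add: equality_system_def)
  have "c ! 0 = c ! 1" if "c \<in> set M" for c
  proof -
    have "count (mset M + S) c \<noteq> 0" using that by simp
    with MS have "\<forall>i<2. \<forall>k<2. c ! i = c ! k"
      unfolding equality_msets_def by blast
    moreover have "0 < (2::nat)" "1 < (2::nat)" by simp_all
    ultimately show ?thesis by blast
  qed
  then have rows: "map (\<lambda>c. c ! 0) M = map (\<lambda>c. c ! 1) M"
    by (intro map_cong refl)
  let ?b = "snd \<phi> (map (\<lambda>c. c ! 0) M)"
  have "apply_rows (snd \<phi>) 2 M = [?b, snd \<phi> (map (\<lambda>c. c ! 1) M)]"
    by (simp add: apply_rows_def numeral_2_eq_2)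
  also have "\<dots> = [?b, ?b]" by (simp only: rows)
  also have "\<dots> = replicate 2 ?b" by (simp add: numeral_2_eq_2)
  finally have "apply_rows (snd \<phi>) 2 M \<in> range (replicate 2)" by (rule image_eqI) simp
  moreover have "S \<in> equality_msets 2"
    by (rule equality_msets_subset[OF _ MS]) simp
  ultimately show "(apply_rows (snd \<phi>) (arity (equality_system 2)) M, S)
      \<in> pmsets (equality_system 2)"
    unfolding equality_system_def pmsystem.sel by (rule SigmaI)
qed

text \<open>
  Applying the operation to the columns of the first block, indeterminates included, yields the new
  column together with its values of the indeterminates, because pulling back along a scheme acts on
  rows and the operation acts on each row separately.
\<close>

lemma preserves_conjunctive_minor:
  assumes s: "s \<in> systems" and t: "t ` J \<subseteq> systems"
    and via: "conjunctive_minor_via V h J t s"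
    and pr: "\<And>j. j \<in> J \<Longrightarrow> preserves \<phi> (t j)"
  shows "preserves \<phi> s"
proof (rule preserves_multisetI[OF s])
  fix M S assume len: "length M = fst \<phi>" and MS: "mset M + S \<in> msets s"
  have scheme: "minor_scheme (arity s) V J (\<lambda>j. arity (t j)) h"
    and res: "restrictive_minor (\<prec>) (arity s) J h (msets s) (\<lambda>j. msets (t j))"
    and ext: "extensive_minor (\<prec>\<^sub>p) (arity s) J h (pmsets s) (\<lambda>j. pmsets (t j))"
    using via by (auto simp: conjunctive_minor_via_def)
  let ?f = "snd \<phi>"
  obtain M2 where M2: "mset M2 = S" using ex_mset by blast
  have on: "set M \<subseteq> tuples (arity s)" "set M2 \<subseteq> tuples (arity s)"
    using systemsD(2)[OF s MS] M2 by auto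
  have "set (M @ M2) \<subseteq> tuples (arity s) \<and> M @ M2 \<prec> msets s"
    using on MS M2 by (simp add: mat_prec_def)
  then have "minor_condition (\<prec>) J h (\<lambda>j. msets (t j)) (M @ M2)"
    by (rule res[unfolded restrictive_minor_def, rule_format])
  then obtain T where T: "image_mset fst T = mset M + S"
      and Tj: "\<forall>j\<in>J. image_mset (pull_column (h j)) T \<in> msets (t j)"
    unfolding minor_condition_mset_iff mset_append M2 by (elim exE conjE)
  obtain T1 T2 where T12: "T = T1 + T2" "image_mset fst T1 = mset M" "image_mset fst T2 = S"
    using image_mset_eq_plusD[OF T] by (elim exE conjE) simp
  obtain L where L: "mset L = T1" "map fst L = M"
    using list_preimage_of_image_mset[OF T12(2)] by (elim exE conjE)
  define y where "y = (apply_rows ?f (arity s) M, \<lambda>v. ?f (map (\<lambda>z. snd z v) L))"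
  have pull: "pull_column (h j) y = apply_rows ?f (arity (t j)) (map (pull_column (h j)) L)"
    if j: "j \<in> J" for j
  proof (rule nth_equalityI)
    have len: "length (h j) = arity (t j)"
      using scheme j by (auto simp: minor_scheme_def)
    then show "length (pull_column (h j) y)
        = length (apply_rows ?f (arity (t j)) (map (pull_column (h j)) L))"
      by (simp add: pull_column_def scheme_apply_def apply_rows_def)
    fix i assume "i < length (pull_column (h j) y)"
    then have i: "i < length (h j)" by (simp add: pull_column_def scheme_apply_def)
    then have "h j ! i \<in> set (h j)" by simp
    moreover have "set (h j) \<subseteq> Inl ` {..<arity s} \<union> Inr ` V"
      using scheme j by (auto simp: minor_scheme_def)
    ultimately have "h j ! i \<in> Inl ` {..<arity s} \<union> Inr ` V" by blast
    with i len show "pull_column (h j) y ! i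
        = apply_rows ?f (arity (t j)) (map (pull_column (h j)) L) ! i"
      unfolding y_def L(2)[symmetric]
      by (auto simp: pull_column_def scheme_apply_def apply_rows_def comp_def)
  qed
  have "(pull_column (h j) y, image_mset (pull_column (h j)) T2) \<in> pmsets (t j)"
    if j: "j \<in> J" for j
  proof -
    have "t j \<in> systems" using t j by blast
    moreover have "mset (map (pull_column (h j)) L) + image_mset (pull_column (h j)) T2
        \<in> msets (t j)"
      using bspec[OF Tj j] unfolding T12(1) L(1)[symmetric] by simp
    moreover have "length (map (pull_column (h j)) L) = fst \<phi>"
      unfolding len[symmetric] L(2)[symmetric] by simp
    ultimately show ?thesis
      unfolding pull[OF j] by (intro preserves_multisetD[OF pr[OF j]])
  qed
  then have "minor_condition (\<prec>\<^sub>p) J h (\<lambda>j. pmsets (t j)) (apply_rows ?f (arity s) M # M2)"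
    unfolding minor_condition_pointed_iff
    using T12(3) M2 by (intro exI[of _ y] exI[of _ T2]) (simp add: y_def)
  with on(2) have "apply_rows ?f (arity s) M # M2 \<prec>\<^sub>p pmsets s"
    by (intro ext[unfolded extensive_minor_def, rule_format]) simp
  then show "(apply_rows ?f (arity s) M, S) \<in> pmsets s"
    using M2 by (simp add: mat_pprec_def)
qed


section \<open>Consequences of the closure conditions\<close>

lemma conjunctive_minor_mem:
  fixes h :: "'j \<Rightarrow> (nat + 'v) list"
  assumes "closed_conjunctive_minors W" "t ` J \<subseteq> W" "s \<in> systems"
    and via: "conjunctive_minor_via V h J t s"
  shows "s \<in> W"
proof -
  have "J \<noteq> {}"
    using via unfolding conjunctive_minor_via_def minor_scheme_def by blast
  then show ?thesis
    using closed_conjunctive_minors_imp_in[OF assms(1), where 'j = 'j and 'v = 'v] assms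
    unfolding closed_conjunctive_minors_in_def by blast
qed

locale closed_class =
  fixes W :: "'a pmsystem set"
  assumes W_systems: "W \<subseteq> systems"
    and local: "locally_closed W"
    and equality: "equality_system 2 \<in> W"
    and unary_trivial: "trivial_system 1 p \<in> W"
    and minors: "closed_conjunctive_minors W"
    and unions: "closed_unions W"
    and quotients: "closed_quotients W"
    and dividends: "closed_dividends W"
begin

lemma in_systems: "s \<in> W \<Longrightarrow> s \<in> systems"
  using W_systems by blast

text \<open>
  The minor along the identity scheme: such minors of a single system weaken the implication from
  multisets to pointed multisets.
\<close>

lemma relaxation_mem:
  assumes s: "s \<in> W" and s': "s' \<in> systems" and ar: "arity s' = arity s"
    and sub: "msets s' \<subseteq> msets s" "pmsets s \<subseteq> pmsets s'"
  shows "s' \<in> W"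
proof -
  let ?h = "map Inl [0..<arity s] :: (nat + unit) list"
  have pull: "pull_column ?h z = fst z" if "fst z \<in> tuples (arity s)" for z
    using that map_nth[of "fst z"] by (simp add: pull_column_def scheme_apply_def tuples_def comp_def)
  have pulls: "image_mset (pull_column ?h) T = image_mset fst T"
    if "image_mset fst T \<in> multisets_on (tuples (arity s))" for T
    using that by (intro image_mset_cong pull) (auto simp: multisets_on_def)
  have "conjunctive_minor_via {} (\<lambda>_. ?h) {()} (\<lambda>_. s) s'"
  proof (rule conjunctive_minor_via_multisets[OF s'])
    show "minor_scheme (arity s') {} {()} (\<lambda>j. arity s) (\<lambda>_. ?h)"
      using systemsD(1)[OF s'] ar unfolding minor_scheme_def by auto
  next
    fix S assume S: "S \<in> msets s'"
    let ?T = "image_mset (\<lambda>a. (a, \<lambda>_ :: unit. undefined :: 'a)) S"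
    have T: "image_mset fst ?T = S" by (simp add: multiset.map_comp comp_def)
    moreover have "S \<in> multisets_on (tuples (arity s))"
      using systemsD(2)[OF s' S] ar by simp
    ultimately have "image_mset (pull_column ?h) ?T = S"
      using pulls[of ?T] by simp
    with T S sub(1) show "\<exists>T. image_mset fst T = S \<and>
        (\<forall>j\<in>{()}. image_mset (pull_column ?h) T \<in> msets s)"
      by (intro exI[of _ ?T]) auto
  next
    fix y :: "'a list \<times> (unit \<Rightarrow> 'a)" and T
    assume y: "fst y \<in> tuples (arity s')"
      and T: "image_mset fst T \<in> multisets_on (tuples (arity s'))"
      and "\<And>j. j \<in> {()} \<Longrightarrow> (pull_column ?h y, image_mset (pull_column ?h) T) \<in> pmsets s"
    then have "(pull_column ?h y, image_mset (pull_column ?h) T) \<in> pmsets s" by simp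
    with sub(2) show "(fst y, image_mset fst T) \<in> pmsets s'"
      using y T ar by (auto simp: pull pulls)
  qed
  then show ?thesis
    by (rule conjunctive_minor_mem[OF minors _ s', rotated]) (use s in simp)
qed

lemma trivial_system_mem:
  assumes m: "1 \<le> m"
  shows "trivial_system m p \<in> W"
proof -
  let ?h = "[Inl 0] :: (nat + unit) list"
  have pull: "pull_column ?h z \<in> tuples 1" for z :: "'a list \<times> (unit \<Rightarrow> 'a)"
    by (simp add: pull_column_def scheme_apply_def tuples_def)
  have pulls: "image_mset (pull_column ?h) T \<in> multisets_on (tuples 1)"
    for T :: "('a list \<times> (unit \<Rightarrow> 'a)) multiset"
    using pull by (auto simp: multisets_on_def)
  have "conjunctive_minor_via {} (\<lambda>_. ?h) {()} (\<lambda>_. trivial_system 1 p) (trivial_system m p :: 'a pmsystem)"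
  proof (rule conjunctive_minor_via_multisets[OF trivial_system_in_systems[OF m]])
    show "minor_scheme (arity (trivial_system m p :: 'a pmsystem)) {} {()}
        (\<lambda>j. arity (trivial_system 1 p :: 'a pmsystem)) (\<lambda>_. ?h)"
      using m unfolding minor_scheme_def by auto
  next
    fix S :: "'a list multiset" assume S: "S \<in> msets (trivial_system m p)"
    let ?T = "image_mset (\<lambda>a. (a, \<lambda>_ :: unit. undefined :: 'a)) S"
    have "image_mset fst ?T = S" by (simp add: multiset.map_comp comp_def)
    moreover have "image_mset (pull_column ?h) ?T \<in> msets (trivial_system 1 p)"
      using S pulls[of ?T] by simp
    ultimately show "\<exists>T. image_mset fst T = S \<and>
        (\<forall>j\<in>{()}. image_mset (pull_column ?h) T \<in> msets (trivial_system 1 p))"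
      by blast
  next
    fix y :: "'a list \<times> (unit \<Rightarrow> 'a)" and T
    assume y: "fst y \<in> tuples (arity (trivial_system m p))"
      and T: "image_mset fst T \<in> multisets_on (tuples (arity (trivial_system m p)))"
      and "\<And>j. j \<in> {()} \<Longrightarrow>
        (pull_column ?h y, image_mset (pull_column ?h) T) \<in> pmsets (trivial_system 1 p)"
    then have "size T < p" by simp
    with y T show "(fst y, image_mset fst T) \<in> pmsets (trivial_system m p)" by simp
  qed
  then show ?thesis
    by (rule conjunctive_minor_mem[OF minors _ trivial_system_in_systems[OF m], rotated])
      (use unary_trivial in simp)
qed

end


section \<open>The minor freely generated by a matrix\<close>

definition matrix_rows :: "nat \<Rightarrow> 'a list list \<Rightarrow> 'a list list" where
  "matrix_rows m N = map (\<lambda>k. map (\<lambda>c. c ! k) N) [0..<m]"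

lemma apply_rows_eq_map: "apply_rows f m N = map f (matrix_rows m N)"
  by (simp add: apply_rows_def matrix_rows_def comp_def)

lemma length_matrix_rows [simp]: "length (matrix_rows m N) = m"
  by (simp add: matrix_rows_def)

lemma matrix_rows_in_tuples: "set (matrix_rows m N) \<subseteq> tuples (length N)"
  by (auto simp: matrix_rows_def tuples_def)

lemma map_nth_matrix_rows:
  assumes "i < length N" "N ! i \<in> tuples m"
  shows "map (\<lambda>r. r ! i) (matrix_rows m N) = N ! i"
  using assms unfolding matrix_rows_def tuples_def by (auto intro: nth_equalityI)

text \<open>
  With the \<open>n\<close>-tuples as indeterminates, \<open>n\<close> being the number of columns of \<open>N\<close>, an assignment of the
  indeterminates is an \<open>n\<close>-ary operation.  The first part of the family says that this operation maps
  every \<open>n\<close>-column matrix allowed by a member of \<open>W\<close> into that member; the second part uses equality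
  systems to tie the \<open>k\<close>-th target coordinate to the value of the operation at the \<open>k\<close>-th row of
  \<open>N\<close>.  Identifying target coordinates with indeterminates directly would be impossible when \<open>N\<close>
  has equal rows.
\<close>

definition free_family ::
    "'a pmsystem set \<Rightarrow> nat \<Rightarrow> 'a list list \<Rightarrow> ('a pmsystem \<times> (nat + 'a list) list) set" where
  "free_family W m N =
     {(s, map Inr (matrix_rows (arity s) C)) |s C.
        s \<in> W \<and> length C = length N \<and> mset C \<in> msets s} \<union>
     {(equality_system 2, [Inl k, Inr (matrix_rows m N ! k)]) |k. k < m}"

definition free_solution ::
    "'a pmsystem set \<Rightarrow> nat \<Rightarrow> 'a list list \<Rightarrow> 'a list \<times> ('a list \<Rightarrow> 'a) \<Rightarrow>
      ('a list \<times> ('a list \<Rightarrow> 'a)) multiset \<Rightarrow> bool" where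
  "free_solution W m N y T \<longleftrightarrow>
     fst y \<in> tuples m \<and> image_mset fst T \<in> multisets_on (tuples m) \<and>
     (\<forall>j\<in>free_family W m N.
        (pull_column (snd j) y, image_mset (pull_column (snd j)) T) \<in> pmsets (fst j))"

definition free_pmsets ::
    "'a pmsystem set \<Rightarrow> nat \<Rightarrow> 'a list list \<Rightarrow> ('a list \<times> 'a list multiset) set" where
  "free_pmsets W m N = {(fst y, image_mset fst T) |y T. free_solution W m N y T}"

text \<open>
  The pointed side consists of exactly the pointed multisets satisfying the minor condition, the
  least choice for an extensive minor.  The other side holds \<open>N\<close> and only what these pointed
  multisets force, so that the system stays below every system that contains \<open>N\<close> and all of them.
\<close>

definition free_system :: "'a pmsystem set \<Rightarrow> nat \<Rightarrow> 'a list list \<Rightarrow> 'a pmsystem" where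
  "free_system W m N = System m
     (insert (mset N) {add_mset x S |x S. (x, S) \<in> free_pmsets W m N}) (free_pmsets W m N)"

lemma free_system_sel [simp]:
  "arity (free_system W m N) = m"
  "msets (free_system W m N) =
     insert (mset N) {add_mset x S |x S. (x, S) \<in> free_pmsets W m N}"
  "pmsets (free_system W m N) = free_pmsets W m N"
  by (simp_all add: free_system_def)

lemma free_pmsetsE:
  assumes "(x, S) \<in> free_pmsets W m N"
  obtains y T where "free_solution W m N y T" "x = fst y" "S = image_mset fst T"
  using assms unfolding free_pmsets_def by blast

lemma free_solution_member:
  fixes W :: "'a pmsystem set"
  assumes "free_solution W m N y T" "s \<in> W" "length C = length N" "mset C \<in> msets s"
  shows "(map (snd y) (matrix_rows (arity s) C),
          image_mset (\<lambda>z. map (snd z) (matrix_rows (arity s) C)) T) \<in> pmsets s"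
proof -
  let ?h = "map Inr (matrix_rows (arity s) C) :: (nat + 'a list) list"
  have "(s, ?h) \<in> free_family W m N"
    using assms unfolding free_family_def by blast
  with assms(1) have "(pull_column ?h y, image_mset (pull_column ?h) T) \<in> pmsets s"
    unfolding free_solution_def by fastforce
  moreover have "pull_column ?h = (\<lambda>z :: 'a list \<times> ('a list \<Rightarrow> 'a). map (snd z) (matrix_rows (arity s) C))"
    by (rule ext) (simp add: pull_column_def scheme_apply_def comp_def)
  ultimately show ?thesis by (simp only:)
qed

lemma free_solution_columns:
  assumes sol: "free_solution W m N y T" and z: "z \<in># add_mset y T"
  shows "fst z = map (snd z) (matrix_rows m N)"
proof (rule nth_equalityI)
  have z': "fst z \<in> tuples m"
    using sol z unfolding free_solution_def multisets_on_def by auto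
  then show "length (fst z) = length (map (snd z) (matrix_rows m N))"
    by (simp add: tuples_def)
  fix k assume "k < length (fst z)"
  with z' have k: "k < m" by (simp add: tuples_def)
  let ?h = "[Inl k, Inr (matrix_rows m N ! k)] :: (nat + 'a list) list"
  have "(equality_system 2, ?h) \<in> free_family W m N"
    using k unfolding free_family_def by blast
  with sol have eq: "(pull_column ?h y, image_mset (pull_column ?h) T) \<in> pmsets (equality_system 2)"
    unfolding free_solution_def by fastforce
  have "pull_column ?h z \<in># add_mset (pull_column ?h y) (image_mset (pull_column ?h) T)"
    using z by auto
  moreover have "add_mset (pull_column ?h y) (image_mset (pull_column ?h) T)
      \<in> msets (equality_system 2)"
    by (rule systemsD(6)[OF equality_system_in_systems[OF one_le_numeral] eq])
  ultimately have "\<forall>i<2. \<forall>l<2. pull_column ?h z ! i = pull_column ?h z ! l"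
    unfolding equality_system_def equality_msets_def pmsystem.sel count_eq_zero_iff by blast
  moreover have "0 < (2::nat)" "1 < (2::nat)" by simp_all
  ultimately have "pull_column ?h z ! 0 = pull_column ?h z ! 1" by blast
  with k show "fst z ! k = map (snd z) (matrix_rows m N) ! k"
    by (simp add: pull_column_def scheme_apply_def)
qed

lemma free_system_in_systems:
  assumes m: "1 \<le> m" and N: "set N \<subseteq> tuples m" and W: "W \<subseteq> systems"
  shows "free_system W m N \<in> systems"
proof (rule systemsI, unfold free_system_sel)
  have on: "x \<in> tuples m" "S \<in> multisets_on (tuples m)" if "(x, S) \<in> free_pmsets W m N" for x S
    using that by (auto elim!: free_pmsetsE simp: free_solution_def)
  show "1 \<le> m" by (rule m)
  show "S \<in> multisets_on (tuples m)"
    if "S \<in> insert (mset N) {add_mset x S |x S. (x, S) \<in> free_pmsets W m N}" for S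
    using that on N by auto
  show "x \<in> tuples m \<and> S \<in> multisets_on (tuples m) \<and>
      add_mset x S \<in> insert (mset N) {add_mset x S |x S. (x, S) \<in> free_pmsets W m N}"
    if "(x, S) \<in> free_pmsets W m N" for x S
    using on[OF that] that by blast
  show "(x, S') \<in> free_pmsets W m N" if xS: "(x, S) \<in> free_pmsets W m N" and sub: "S' \<subseteq># S" for x S S'
  proof -
    obtain y T where sol: "free_solution W m N y T" and x: "x = fst y" and S: "S = image_mset fst T"
      using xS by (rule free_pmsetsE)
    obtain R where "S = S' + R" using sub by (metis mset_subset_eq_exists_conv)
    then have "image_mset fst T = S' + R" using S by simp
    then obtain T' R' where T: "T = T' + R'" "S' = image_mset fst T'"
      by (elim image_mset_eq_plusD[THEN exE] exE conjE)
    have src: "fst j \<in> systems" if "j \<in> free_family W m N" for j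
      using that W equality_system_in_systems[OF one_le_numeral] unfolding free_family_def by auto
    have "free_solution W m N y T'"
      unfolding free_solution_def
    proof (intro conjI ballI)
      show "fst y \<in> tuples m" "image_mset fst T' \<in> multisets_on (tuples m)"
        using sol T unfolding free_solution_def by auto
      fix j assume j: "j \<in> free_family W m N"
      show "(pull_column (snd j) y, image_mset (pull_column (snd j)) T') \<in> pmsets (fst j)"
        by (rule systemsD(5)[OF src[OF j], of _ "image_mset (pull_column (snd j)) T"])
          (use sol j T(1) in \<open>auto simp: free_solution_def\<close>)
    qed
    with x T(2) show ?thesis unfolding free_pmsets_def by blast
  qed
qed

text \<open>
  The projections solve all conditions on the columns of \<open>N\<close> itself: the \<open>i\<close>-th column of \<open>N\<close>, and of
  every matrix in the family, is obtained by applying the \<open>i\<close>-th projection to the rows.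
\<close>

lemma projections_solve_free_family:
  assumes N: "set N \<subseteq> tuples m" and W: "W \<subseteq> systems" and j: "j \<in> free_family W m N"
  shows "mset (map (\<lambda>i. pull_column (snd j) (N ! i, \<lambda>r. r ! i)) [0..<length N]) \<in> msets (fst j)"
  using j unfolding free_family_def
proof (elim UnE CollectE exE conjE)
  fix s C assume j: "j = (s, map Inr (matrix_rows (arity s) C))"
    and s: "s \<in> W" and C: "length C = length N" "mset C \<in> msets s"
  have "set C \<subseteq> tuples (arity s)"
    using systemsD(2)[of s, OF _ C(2)] s W by auto
  then have "C ! i \<in> tuples (arity s)" if "i < length N" for i
    using that C(1) by auto
  then have "pull_column (snd j) (N ! i, \<lambda>r. r ! i) = C ! i" if "i < length N" for i
    using that C(1) map_nth_matrix_rows[of i C "arity s"]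
    by (simp add: j pull_column_def scheme_apply_def comp_def)
  then have "map (\<lambda>i. pull_column (snd j) (N ! i, \<lambda>r. r ! i)) [0..<length N] = C"
    using C(1) by (intro nth_equalityI) auto
  with C(2) j show ?thesis by simp
next
  fix k assume j: "j = (equality_system 2, [Inl k, Inr (matrix_rows m N ! k)])" and k: "k < m"
  have pull: "pull_column (snd j) (N ! i, \<lambda>r. r ! i) = replicate 2 (N ! i ! k)"
    if "i < length N" for i
    using that k by (simp add: j pull_column_def scheme_apply_def matrix_rows_def numeral_2_eq_2)
  have "set (map (\<lambda>i. pull_column (snd j) (N ! i, \<lambda>r. r ! i)) [0..<length N])
      \<subseteq> range (replicate 2)"
    using pull by auto
  then have "mset (map (\<lambda>i. pull_column (snd j) (N ! i, \<lambda>r. r ! i)) [0..<length N])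
      \<in> equality_msets 2" (is "mset ?L \<in> _")
  proof -
    assume L: "set ?L \<subseteq> range (replicate 2)"
    have "mset ?L \<in> multisets_on (tuples 2)"
      using L unfolding multisets_on_mset by (auto simp: tuples_def)
    moreover have "\<forall>i<2. \<forall>l<2. a ! i = a ! l" if "count (mset ?L) a \<noteq> 0" for a
    proof -
      have "a \<in> set ?L" using that by (metis count_eq_zero_iff set_mset_mset)
      with L obtain b where "a = replicate 2 b" by blast
      then show ?thesis by simp
    qed
    ultimately show ?thesis unfolding equality_msets_def by blast
  qed
  with j show ?thesis by (simp add: equality_system_def)
qed


section \<open>Operations preserving all members of a class\<close>

definition polymorphisms :: "'a pmsystem set \<Rightarrow> (nat \<times> ('a list \<Rightarrow> 'a)) set" where
  "polymorphisms W = {\<phi> \<in> operations. \<forall>s\<in>W. preserves \<phi> s}"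

context closed_class
begin

lemma free_system_mem:
  assumes m: "1 \<le> m" and N: "set N \<subseteq> tuples m"
  shows "free_system W m N \<in> W"
proof (rule conjunctive_minor_mem[OF minors])
  let ?J = "free_family W m N"
  let ?s = "free_system W m N"
  show sources: "fst ` ?J \<subseteq> W"
    using equality unfolding free_family_def by auto
  show sys: "?s \<in> systems"
    by (rule free_system_in_systems[OF m N W_systems])
  show "conjunctive_minor_via UNIV snd ?J fst ?s"
  proof (rule conjunctive_minor_via_multisets[OF sys])
    have "?J \<noteq> {}" using m unfolding free_family_def by fastforce
    moreover have "1 \<le> arity (fst j)" if "j \<in> ?J" for j
      using sources that by (intro systemsD(1) in_systems) blast
    moreover have "length (snd j) = arity (fst j)" "set (snd j) \<subseteq> Inl ` {..<m} \<union> Inr ` UNIV"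
      if "j \<in> ?J" for j
      using that unfolding free_family_def by (auto simp: equality_system_def)
    ultimately show "minor_scheme (arity ?s) UNIV ?J (\<lambda>j. arity (fst j)) snd"
      using m by (simp add: minor_scheme_def)
  next
    fix S assume "S \<in> msets ?s"
    then consider "S = mset N" | x S' where "S = add_mset x S'" "(x, S') \<in> free_pmsets W m N"
      by auto
    then show "\<exists>T. image_mset fst T = S \<and>
        (\<forall>j\<in>?J. image_mset (pull_column (snd j)) T \<in> msets (fst j))"
    proof cases
      case 1
      let ?T = "mset (map (\<lambda>i. (N ! i, \<lambda>r. r ! i)) [0..<length N])"
      have "image_mset fst ?T = mset (map (\<lambda>i. N ! i) [0..<length N])"
        by (simp only: mset_map[symmetric] map_map comp_def fst_conv)
      then have "image_mset fst ?T = S" by (simp only: 1 map_nth)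
      moreover have "image_mset (pull_column (snd j)) ?T \<in> msets (fst j)" if "j \<in> ?J" for j
        using projections_solve_free_family[OF N W_systems that]
        by (simp only: mset_map[symmetric] map_map comp_def)
      ultimately show ?thesis by blast
    next
      case (2 x S')
      obtain y T where sol: "free_solution W m N y T" "x = fst y" "S' = image_mset fst T"
        using 2(2) by (rule free_pmsetsE)
      have "image_mset (pull_column (snd j)) (add_mset y T) \<in> msets (fst j)" if j: "j \<in> ?J" for j
      proof -
        have "fst j \<in> systems" using sources j in_systems by blast
        then have "add_mset (pull_column (snd j) y) (image_mset (pull_column (snd j)) T)
            \<in> msets (fst j)"
          by (rule systemsD(6)) (use sol(1) j in \<open>simp add: free_solution_def\<close>)
        then show ?thesis by simp
      qed
      with sol 2(1) show ?thesis by (intro exI[of _ "add_mset y T"]) simp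
    qed
  next
    fix y :: "'a list \<times> ('a list \<Rightarrow> 'a)" and T
    assume "fst y \<in> tuples (arity ?s)" "image_mset fst T \<in> multisets_on (tuples (arity ?s))"
      and "\<And>j. j \<in> ?J \<Longrightarrow> (pull_column (snd j) y, image_mset (pull_column (snd j)) T)
          \<in> pmsets (fst j)"
    then have "free_solution W m N y T" by (simp add: free_solution_def)
    then show "(fst y, image_mset fst T) \<in> pmsets ?s"
      unfolding free_system_sel free_pmsets_def by blast
  qed
qed

lemma free_pmsets_subset:
  assumes s: "s \<in> W" and N: "mset N \<in> msets s"
  shows "free_pmsets W (arity s) N \<subseteq> pmsets s"
proof (rule subrelI)
  fix x S assume "(x, S) \<in> free_pmsets W (arity s) N"
  then obtain y T where sol: "free_solution W (arity s) N y T"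
      and x: "x = fst y" and S: "S = image_mset fst T"
    by (rule free_pmsetsE)
  have "S = image_mset (\<lambda>z. map (snd z) (matrix_rows (arity s) N)) T"
    unfolding S by (intro image_mset_cong free_solution_columns[OF sol]) simp
  moreover have "x = map (snd y) (matrix_rows (arity s) N)"
    unfolding x by (rule free_solution_columns[OF sol]) simp
  ultimately show "(x, S) \<in> pmsets s"
    using free_solution_member[OF sol s refl N] by simp
qed

text \<open>
  The operation read off from a solution preserves the members of \<open>W\<close> for an arbitrary second block,
  although the family only speaks about matrices consisting of the first block: a second block is
  absorbed by passing to a quotient, which is again a member.
\<close>

lemma free_solution_operation:
  assumes N: "N \<noteq> []" and sol: "free_solution W m N y T"
  shows "(length N, restrict (snd y) (tuples (length N))) \<in> polymorphisms W"
    (is "(_, ?f) \<in> _")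
  unfolding polymorphisms_def
proof (intro CollectI conjI ballI)
  show "(length N, ?f) \<in> operations"
    using N by (cases N) (auto simp: operations_def)
  fix s assume s: "s \<in> W"
  show "preserves (length N, ?f) s"
  proof (rule preserves_multisetI[OF in_systems[OF s]])
    fix C S assume "length C = fst (length N, ?f)" and CS: "mset C + S \<in> msets s"
    then have C: "length C = length N" by simp
    let ?s = "system_quotient s S"
    have on: "mset C \<in> multisets_on (tuples (arity s))" "S \<in> multisets_on (tuples (arity s))"
      using systemsD(2)[OF in_systems[OF s] CS] by simp_all
    have q: "?s \<in> W"
      using quotients s on(2) by (simp add: closed_quotients_def)
    have "mset C \<in> msets ?s"
      using CS on(1) by (simp add: add.commute)
    from systemsD(5)[OF in_systems[OF q] free_solution_member[OF sol q C this] empty_le]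
    have "(map (snd y) (matrix_rows (arity s) C), {#}) \<in> pmsets ?s"
      by (simp only: quotient_sel)
    moreover have "map (snd y) (matrix_rows (arity s) C) = apply_rows ?f (arity s) C"
      using matrix_rows_in_tuples[of "arity s" C] C unfolding apply_rows_eq_map by auto
    ultimately show "(apply_rows (snd (length N, ?f)) (arity s) C, S) \<in> pmsets s"
      by simp
  qed
qed

text \<open>
  A system \<open>t\<close> is, up to relaxation, the union of the free systems of the matrices in \<open>msets t\<close>.  These
  stay below \<open>t\<close>: if \<open>(x, {#})\<close> belongs to a free system, then \<open>x\<close> is the image of the matrix under
  an operation preserving \<open>W\<close>, which preserves \<open>t\<close> by hypothesis; and a pair \<open>(x, S)\<close>
  with nonempty \<open>S\<close> belongs to the union of \<open>t\<close> with the trivial system of breadth one, which contains no such pair outside \<open>t\<close>.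
\<close>

lemma mem_if_union_breadth_one_mem:
  assumes t: "t \<in> systems" and one: "system_union t (trivial_system (arity t) 1) \<in> W"
    and empty: "{#} \<in> msets t"
    and pres: "\<And>\<phi>. \<phi> \<in> polymorphisms W \<Longrightarrow> preserves \<phi> t"
  shows "t \<in> W"
proof -
  let ?m = "arity t"
  have m: "1 \<le> ?m" by (rule systemsD(1)[OF t])
  have below: "\<exists>u\<in>W. arity u = ?m \<and> S \<in> msets u \<and> msets u \<subseteq> msets t \<and> pmsets u \<subseteq> pmsets t"
    if S: "S \<in> msets t" for S
  proof (cases "S = {#}")
    case True
    \<comment> \<open>No operation is nullary, so the free system of a matrix without columns is not controlled
      by operations; the trivial system of breadth zero takes its place.\<close>
    then show ?thesis
      using trivial_system_mem[OF m, of 0] empty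
      by (intro bexI[of _ "trivial_system ?m 0"]) (auto simp del: split_paired_All)
  next
    case False
    obtain N where N: "mset N = S" using ex_mset by blast
    have N0: "N \<noteq> []" using False N by auto
    have on: "set N \<subseteq> tuples ?m"
      using systemsD(2)[OF t S] N by auto
    have "mset N \<in> msets (system_union t (trivial_system ?m 1))"
      using S N by simp
    from free_pmsets_subset[OF one this]
    have sub1: "free_pmsets W ?m N \<subseteq> pmsets t \<union> pmsets (trivial_system ?m 1)"
      by simp
    have sub: "free_pmsets W ?m N \<subseteq> pmsets t"
    proof (rule subrelI)
      fix x R assume xR: "(x, R) \<in> free_pmsets W ?m N"
      show "(x, R) \<in> pmsets t"
      proof (cases "R = {#}")
        case False
        then have "(x, R) \<notin> pmsets (trivial_system ?m 1)" by simp
        with xR sub1 show ?thesis by blast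
      next
        case True
        from xR obtain y T where sol: "free_solution W ?m N y T" and x: "x = fst y"
          by (rule free_pmsetsE)
        let ?f = "restrict (snd y) (tuples (length N))"
        have "(apply_rows (snd (length N, ?f)) ?m N, {#}) \<in> pmsets t"
          by (rule preserves_multisetD[OF pres[OF free_solution_operation[OF N0 sol]] t])
            (use S N in simp_all)
        moreover have "apply_rows ?f ?m N = x"
        proof -
          have "x = map (snd y) (matrix_rows ?m N)"
            unfolding x by (rule free_solution_columns[OF sol]) simp
          then show ?thesis
            using matrix_rows_in_tuples[of ?m N] unfolding apply_rows_eq_map by auto
        qed
        ultimately show ?thesis using True by simp
      qed
    qed
    moreover have "msets (free_system W ?m N) \<subseteq> msets t"
      using S N sub systemsD(6)[OF t] by auto
    ultimately show ?thesis
      using N by (intro bexI[OF _ free_system_mem[OF m on]]) auto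
  qed
  define G where "G = {u \<in> W. arity u = ?m \<and> msets u \<subseteq> msets t \<and> pmsets u \<subseteq> pmsets t}"
  let ?U = "System ?m (\<Union>u\<in>G. msets u) (\<Union>u\<in>G. pmsets u)"
  have "G \<noteq> {}" using below[OF empty] unfolding G_def by blast
  moreover have "G \<subseteq> W" "\<forall>u\<in>G. arity u = ?m" unfolding G_def by auto
  ultimately have "?U \<in> W" using unions unfolding closed_unions_def by blast
  then show ?thesis
  proof (rule relaxation_mem[OF _ t])
    show "msets t \<subseteq> msets ?U"
      using below unfolding G_def by fastforce
    show "pmsets ?U \<subseteq> pmsets t"
      unfolding G_def by auto
  qed simp
qed

text \<open>
  Adjoining ever smaller trivial systems.  Each step down is a dividend: quotients by multisets
  larger than the breadth \<open>q\<close> are relaxations of quotients already in \<open>W\<close>, and for quotients by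
  multisets of size exactly \<open>q\<close> the adjoined trivial systems have breadth zero and one.
\<close>

lemma union_trivial_step:
  assumes s: "s \<in> systems" and pres: "\<And>\<phi>. \<phi> \<in> polymorphisms W \<Longrightarrow> preserves \<phi> s"
    and up: "system_union s (trivial_system (arity s) (Suc q)) \<in> W"
  shows "system_union s (trivial_system (arity s) q) \<in> W"
proof -
  let ?m = "arity s"
  let ?s = "\<lambda>q. system_union s (trivial_system ?m q)"
  have m: "1 \<le> ?m" by (rule systemsD(1)[OF s])
  have sys: "?s p \<in> systems" for p
    by (rule union_in_systems[OF s trivial_system_in_systems[OF m]]) simp
  have "system_quotient (?s q) S \<in> W" if S: "S \<in> multisets_on (tuples ?m)" "q \<le> size S" for S
  proof -
    let ?t = "system_quotient (?s q) S"
    have t: "?t \<in> systems" by (rule quotient_in_systems[OF sys])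
    have up': "system_quotient (?s (Suc q)) S \<in> W"
      using quotients up S(1) by (simp add: closed_quotients_def)
    show ?thesis
    proof (cases "size S = q")
      case False
      with S(2) show ?thesis
        by (intro relaxation_mem[OF up' t]) auto
    next
      case True
      show ?thesis
      proof (rule mem_if_union_breadth_one_mem[OF t])
        show "system_union ?t (trivial_system (arity ?t) 1) \<in> W"
        proof (rule relaxation_mem[OF up'])
          show "system_union ?t (trivial_system (arity ?t) 1) \<in> systems"
            by (rule union_in_systems[OF t trivial_system_in_systems]) (use m in simp_all)
          show "msets (system_union ?t (trivial_system (arity ?t) 1))
              \<subseteq> msets (system_quotient (?s (Suc q)) S)"
            using True S(1) by auto
          show "pmsets (system_quotient (?s (Suc q)) S)
              \<subseteq> pmsets (system_union ?t (trivial_system (arity ?t) 1))"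
            using True by auto
        qed simp
        show "{#} \<in> msets ?t" using S(1) True by simp
        fix \<phi> assume \<phi>: "\<phi> \<in> polymorphisms W"
        then have "1 \<le> fst \<phi>" by (auto simp: polymorphisms_def operations_def)
        then have "preserves \<phi> (?s q)"
          using pres[OF \<phi>] m
          by (intro preserves_union[OF s trivial_system_in_systems]) (simp_all add: preserves_trivial_system)
        then show "preserves \<phi> ?t" by (rule preserves_quotient[OF sys])
      qed
    qed
  qed
  moreover have "system_le (trivial_system ?m q) (?s q)"
    by (simp add: system_le_def)
  ultimately show ?thesis
    using dividends sys unfolding closed_dividends_def by fastforce
qed

lemma mem_if_preserved:
  assumes s: "s \<in> systems" and pres: "\<And>\<phi>. \<phi> \<in> polymorphisms W \<Longrightarrow> preserves \<phi> s"
  shows "s \<in> W"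
proof -
  have m: "1 \<le> arity s" by (rule systemsD(1)[OF s])
  have "restrict_breadth s p \<in> W" for p
  proof -
    let ?r = "restrict_breadth s p"
    have r: "?r \<in> systems" by (rule restrict_breadth_in_systems[OF s])
    have pres': "preserves \<phi> ?r" if "\<phi> \<in> polymorphisms W" for \<phi>
      using that by (intro preserves_restrict_breadth[OF s pres])
        (auto simp: polymorphisms_def operations_def)
    have down: "system_union ?r (trivial_system (arity s) (p - k)) \<in> W" for k
    proof (induction k)
      case 0
      have "system_union ?r (trivial_system (arity s) p) = trivial_system (arity s) p"
        by (auto intro!: pmsystem.expand)
      then show ?case using trivial_system_mem[OF m, of p] by simp
    next
      case (Suc k)
      show ?case
      proof (cases "k < p")
        case True
        then have "p - k = Suc (p - Suc k)" by simp
        with Suc union_trivial_step[OF r pres', of "p - Suc k"] show ?thesis by simp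
      next
        case False
        with Suc show ?thesis by simp
      qed
    qed
    have "system_union ?r (trivial_system (arity s) 0) \<in> W" using down[of p] by simp
    then show ?thesis
      by (rule relaxation_mem[OF _ r]) auto
  qed
  with s local show ?thesis unfolding locally_closed_def by blast
qed

lemma characterized_by_polymorphisms: "characterized_by W (polymorphisms W)"
  using mem_if_preserved in_systems
  unfolding characterized_by_def by (auto simp: polymorphisms_def)

end


section \<open>Classes characterized by operations\<close>

lemma preserves_if_restrictions_preserved:
  assumes s: "s \<in> systems" and pr: "\<And>p. preserves \<phi> (restrict_breadth s p)"
  shows "preserves \<phi> s"
proof (rule preserves_multisetI[OF s])
  fix M S assume M: "length M = fst \<phi>" and MS: "mset M + S \<in> msets s"
  let ?r = "restrict_breadth s (size (mset M + S))"
  have "mset M + S \<in> msets ?r"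
    using MS systemsD(2)[OF s MS] by simp
  from preserves_multisetD[OF pr restrict_breadth_in_systems[OF s] M this]
  show "(apply_rows (snd \<phi>) (arity s) M, S) \<in> pmsets s" by simp
qed

text \<open>
  A large second block is moved into the quotient; for a small one the required pointed multiset
  already belongs to the trivial system.
\<close>

lemma preserves_dividend:
  assumes s: "s \<in> systems" and triv: "system_le (trivial_system (arity s) p) s"
    and pr: "\<And>S. S \<in> multisets_on (tuples (arity s)) \<Longrightarrow> p \<le> size S \<Longrightarrow>
      preserves \<phi> (system_quotient s S)"
  shows "preserves \<phi> s"
proof (rule preserves_multisetI[OF s])
  fix M S assume M: "length M = fst \<phi>" and MS: "mset M + S \<in> msets s"
  have on: "mset M \<in> multisets_on (tuples (arity s))" "S \<in> multisets_on (tuples (arity s))"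
    using systemsD(2)[OF s MS] by simp_all
  show "(apply_rows (snd \<phi>) (arity s) M, S) \<in> pmsets s"
  proof (cases "p \<le> size S")
    case True
    have "mset M + {#} \<in> msets (system_quotient s S)"
      using MS on(1) by (simp add: add.commute)
    from preserves_multisetD[OF pr[OF on(2) True] quotient_in_systems[OF s] M this]
    show ?thesis by simp
  next
    case False
    then have "(apply_rows (snd \<phi>) (arity s) M, S) \<in> pmsets (trivial_system (arity s) p)"
      using on(2) by simp
    with triv show ?thesis unfolding system_le_def by blast
  qed
qed

theorem theorem3p9:
  fixes W :: "'a pmsystem set"
  assumes "W \<subseteq> systems"
  shows "(locally_closed W \<and>
          equality_system 2 \<in> W \<and>
          empty_system 1 \<in> W \<and>
          (\<forall>p. trivial_system 1 p \<in> W) \<and>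
          closed_conjunctive_minors W \<and>
          closed_unions W \<and>
          closed_quotients W \<and>
          closed_dividends W) \<longleftrightarrow>
         (\<exists>F. F \<subseteq> operations \<and> characterized_by W F)"
    (is "?closed \<longleftrightarrow> ?characterized")
proof
  assume ?closed
  then interpret closed_class W
    using assms by unfold_locales blast+
  have "polymorphisms W \<subseteq> operations"
    unfolding polymorphisms_def by blast
  with characterized_by_polymorphisms show ?characterized by blast
next
  assume ?characterized
  then obtain F where F: "F \<subseteq> operations"
      and W: "W = {s \<in> systems. \<forall>\<phi>\<in>F. preserves \<phi> s}"
    unfolding characterized_by_def by blast
  have WI: "s \<in> W" if "s \<in> systems" "\<And>\<phi>. \<phi> \<in> F \<Longrightarrow> preserves \<phi> s" for s
    using that unfolding W by blast
  have sys: "s \<in> systems" if "s \<in> W" for s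
    using that unfolding W by blast
  have pr: "preserves \<phi> s" if "\<phi> \<in> F" "s \<in> W" for \<phi> s
    using that unfolding W by blast
  have pos: "1 \<le> fst \<phi>" if "\<phi> \<in> F" for \<phi>
    using that F by (auto simp: operations_def)
  have "locally_closed W"
    unfolding locally_closed_def
  proof (intro ballI impI)
    fix s :: "'a pmsystem" assume s: "s \<in> systems" and r: "\<forall>p. restrict_breadth s p \<in> W"
    show "s \<in> W"
      by (rule WI[OF s], rule preserves_if_restrictions_preserved[OF s], rule pr) (use r in blast)+
  qed
  moreover have "equality_system 2 \<in> W"
    by (rule WI[OF equality_system_in_systems preserves_equality_system]) simp
  moreover have "empty_system 1 \<in> W"
    by (rule WI[OF empty_system_in_systems preserves_empty_system]) simp_all
  moreover have "trivial_system 1 p \<in> W" for p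
    by (rule WI[OF trivial_system_in_systems preserves_trivial_system[OF pos]]) simp_all
  moreover have "closed_conjunctive_minors W"
    unfolding closed_conjunctive_minors_def closed_conjunctive_minors_in_def
  proof (intro allI impI, elim conjE)
    fix V :: "'a indet set" and h and J :: "'a minor_index set" and t s
    assume t: "t ` J \<subseteq> W" and s: "s \<in> systems" and via: "conjunctive_minor_via V h J t s"
    show "s \<in> W"
    proof (rule WI[OF s])
      fix \<phi> assume \<phi>: "\<phi> \<in> F"
      show "preserves \<phi> s"
      proof (rule preserves_conjunctive_minor[OF s _ via])
        show "t ` J \<subseteq> systems" using t assms by blast
        show "preserves \<phi> (t j)" if "j \<in> J" for j
          using pr[OF \<phi>] t that by blast
      qed
    qed
  qed
  moreover have "closed_unions W"
    unfolding closed_unions_def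
  proof (intro allI impI, elim conjE)
    fix m and G :: "'a pmsystem set"
    assume G: "G \<noteq> {}" "G \<subseteq> W" "\<forall>s\<in>G. arity s = m"
    then have G': "G \<subseteq> systems" using assms by blast
    show "System m (\<Union>s\<in>G. msets s) (\<Union>s\<in>G. pmsets s) \<in> W"
      by (rule WI[OF Union_in_systems[OF G(1) G' G(3)]], rule preserves_Union[OF G(1) G' G(3)])
        (use pr G(2) in blast)
  qed
  moreover have "closed_quotients W"
    unfolding closed_quotients_def
    by (intro ballI, rule WI[OF quotient_in_systems preserves_quotient]) (simp_all add: sys pr)
  moreover have "closed_dividends W"
    unfolding closed_dividends_def
  proof (intro ballI impI, elim exE conjE)
    fix s :: "'a pmsystem" and p
    assume s: "s \<in> systems" and triv: "system_le (trivial_system (arity s) p) s"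
      and q: "\<forall>S\<in>multisets_on (tuples (arity s)). p \<le> size S \<longrightarrow> system_quotient s S \<in> W"
    show "s \<in> W"
      by (rule WI[OF s], rule preserves_dividend[OF s triv], rule pr) (use q in blast)+
  qed
  ultimately show ?closed by blast
qed

end
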